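(* Let $a=(a_i)_{i\in\mathbb Z}$ be an arbitrary sequence of complex numbers. The multiparameter Schur functions satisfy the Giambelli formula: for every Young diagram $\mu$, $$s_{\mu;a}=\det[s_{(p_i\,|\,q_j);a}]_{i,j=1}^d,$$ where $d=d(\mu)$ and $p_1,\dots,p_d;q_1,\dots,q_d$ are the Frobenius coordinates of $\mu$.
   Context: The base field is $\mathbb C$. $\Lambda=\mathbb C[\mathbf p_1,\mathbf p_2,\dots]$ is the algebra of symmetric functions (polynomial ring in the power sums). Its elements $h_k$ are defined by $H(u)=1+\sum_{k\ge1}h_ku^{-k}=\exp\big(\sum_{k\ge1}\mathbf p_ku^{-k}/k\big)\in\Lambda[[u^{-1}]]$. For a sequence $a=(a_i)_{i\in\mathbb Z}$, the elements $h_{k;a}\in\Lambda$ are defined by $$1+\sum_{k\ge1}\frac{h_{k;a}}{(u-a_1)\cdots(u-a_k)}=H(u)$$ in $\Lambda[[u^{-1}]]$, with $h_{0;a}=1$ and $h_{k;a}=0$ for $k<0$. For $r\in\mathbb Z$, $(\tau^ra)_i=a_{i+r}$. The multiparameter Schur function is $s_{\mu;a}=\det[h_{\mu_i-i+j;\,\tau^{1-j}a}]$, where the order of the determinant is any number $\ge\ell(\mu)$, the number of nonzero rows of $\mu$. $d(\mu)$ is the number of diagonal squares of $\mu$; the Frobenius coordinates are $p_i=\mu_i-i$, $q_i=\mu'_i-i$, $1\le i\le d(\mu)$, with $\mu'$ the transposed diagram. $(p\,|\,q)$ denotes the hook diagram $(p+1,1^q)$. *)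

theory Defs
  imports
    "HOL-Library.Poly_Mapping"
    "HOL-Computational_Algebra.Formal_Power_Series"
    "Jordan_Normal_Form.Determinant"
begin

section \<open>The algebra of symmetric functions\<close>

text \<open>
  Polynomials over the complex numbers in countably many variables: finitely supported functions
  from monomials (finitely supported exponent functions) to coefficients. The variable with
  index \<open>n\<close> is the power sum of degree \<open>n + 1\<close>, so that there is no variable of degree 0.
\<close>
type_synonym symf = "(nat \<Rightarrow>\<^sub>0 nat) \<Rightarrow>\<^sub>0 complex"

definition scalar :: "complex \<Rightarrow> symf" where
  "scalar c = Poly_Mapping.single 0 c"

text \<open>Only meant for \<open>k \<ge> 1\<close>.\<close>
definition power_sum :: "nat \<Rightarrow> symf" where
  "power_sum k = Poly_Mapping.single (Poly_Mapping.single (k - 1) 1) 1"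

text \<open>
  A series in \<open>u\<^sup>-\<^sup>1\<close> is an \<open>fps\<close> whose variable \<open>fps_X\<close> stands for \<open>u\<^sup>-\<^sup>1\<close>.
  The exponential is spelled out because \<open>fps_exp\<close> needs a field of coefficients.
\<close>
definition H_series :: "symf fps" where
  "H_series = Abs_fps (\<lambda>n. scalar (1 / fact n)) oo
     Abs_fps (\<lambda>k. if k = 0 then 0 else scalar (1 / of_nat k) * power_sum k)"

section \<open>Multiparameter complete symmetric functions\<close>

text \<open>The expansion \<open>(u - c)\<^sup>-\<^sup>1 = (\<Sum>n. c\<^sup>n u\<^sup>-\<^sup>n\<^sup>-\<^sup>1)\<close>; see \<open>inv_linear_characterization\<close>.\<close>
definition inv_linear :: "complex \<Rightarrow> symf fps" where
  "inv_linear c = fps_X * Abs_fps (\<lambda>n. scalar (c ^ n))"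

definition inv_shifted_power :: "(int \<Rightarrow> complex) \<Rightarrow> nat \<Rightarrow> symf fps" where
  "inv_shifted_power a k = (\<Prod>i = 1..k. inv_linear (a (int i)))"

text \<open>
  Convergence is in the \<open>fps_X\<close>-adic topology of the library. The defining property determines
  the sequence uniquely, see \<open>ex1_h_expansion\<close>.
\<close>
definition is_h_expansion :: "(int \<Rightarrow> complex) \<Rightarrow> (nat \<Rightarrow> symf) \<Rightarrow> bool" where
  "is_h_expansion a h \<longleftrightarrow>
     h 0 = 1 \<and> (\<lambda>k. fps_const (h k) * inv_shifted_power a k) sums H_series"

definition h_multi :: "(int \<Rightarrow> complex) \<Rightarrow> int \<Rightarrow> symf" where
  "h_multi a k = (if k < 0 then 0 else (THE h. is_h_expansion a h) (nat k))"

definition shift :: "int \<Rightarrow> (int \<Rightarrow> complex) \<Rightarrow> (int \<Rightarrow> complex)" where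
  "shift r a = (\<lambda>i. a (i + r))"

section \<open>Young diagrams\<close>

text \<open>A Young diagram is given by the list of the lengths of its nonzero rows.\<close>
definition young :: "nat list \<Rightarrow> bool" where
  "young \<mu> \<longleftrightarrow> sorted_wrt (\<ge>) \<mu> \<and> 0 \<notin> set \<mu>"

text \<open>Rows, columns and squares are numbered from 1.\<close>
definition row_len :: "nat list \<Rightarrow> nat \<Rightarrow> nat" where
  "row_len \<mu> i = (if 1 \<le> i \<and> i \<le> length \<mu> then \<mu> ! (i - 1) else 0)"

definition squares :: "nat list \<Rightarrow> (nat \<times> nat) set" where
  "squares \<mu> = {(i, j). 1 \<le> i \<and> 1 \<le> j \<and> j \<le> row_len \<mu> i}"

text \<open>The \<open>j\<close>-th row of the transposed diagram.\<close>
definition col_len :: "nat list \<Rightarrow> nat \<Rightarrow> nat" where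
  "col_len \<mu> j = card {i. (i, j) \<in> squares \<mu>}"

definition diag_length :: "nat list \<Rightarrow> nat" where
  "diag_length \<mu> = card {i. (i, i) \<in> squares \<mu>}"

text \<open>
  Frobenius coordinates, only meant for \<open>1 \<le> i \<le> diag_length \<mu>\<close>; the subtractions do
  not truncate in this range.
\<close>
definition frob_p :: "nat list \<Rightarrow> nat \<Rightarrow> nat" where
  "frob_p \<mu> i = row_len \<mu> i - i"

definition frob_q :: "nat list \<Rightarrow> nat \<Rightarrow> nat" where
  "frob_q \<mu> i = col_len \<mu> i - i"

definition hook :: "nat \<Rightarrow> nat \<Rightarrow> nat list" where
  "hook p q = (p + 1) # replicate q 1"

section \<open>Multiparameter Schur functions\<close>

text \<open>The matrix entries are indexed from 0, hence the \<open>Suc\<close>.\<close>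
definition jacobi_trudi :: "(int \<Rightarrow> complex) \<Rightarrow> nat list \<Rightarrow> nat \<Rightarrow> symf mat" where
  "jacobi_trudi a \<mu> n = mat n n (\<lambda>(i', j'). let i = Suc i'; j = Suc j' in
     h_multi (shift (1 - int j) a) (int (row_len \<mu> i) - int i + int j))"

text \<open>
  Any order at least \<open>length \<mu>\<close> gives the same determinant, see \<open>schur_multi_any_order\<close>.
\<close>
definition schur_multi :: "(int \<Rightarrow> complex) \<Rightarrow> nat list \<Rightarrow> symf" where
  "schur_multi a \<mu> = det (jacobi_trudi a \<mu> (length \<mu>))"

section \<open>Well-definedness\<close>

no_notation vec_index (infixl "$" 100)
notation fps_nth (infixl "$" 75)

lemma scalar_0: "scalar 0 = 0" and scalar_1: "scalar 1 = 1"
  and scalar_mult: "scalar (b * c) = scalar b * scalar c"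
  by (simp_all add: scalar_def mult_single)

lemma inv_linear_characterization:
  "(1 - fps_const (scalar c) * fps_X) * inv_linear c = fps_X"
proof -
  have "(1 - fps_const (scalar c) * fps_X) * Abs_fps (\<lambda>n. scalar (c ^ n)) = 1"
  proof (rule fps_ext)
    fix n
    show "((1 - fps_const (scalar c) * fps_X) * Abs_fps (\<lambda>n. scalar (c ^ n))) $ n = 1 $ n"
      by (cases n)
         (simp_all add: left_diff_distrib mult.assoc scalar_1 flip: scalar_mult)
  qed
  thus ?thesis
    by (simp add: inv_linear_def mult.left_commute)
qed

lemma inv_shifted_power_nth:
  "inv_shifted_power a k = fps_X ^ k * (\<Prod>i = 1..k. Abs_fps (\<lambda>n. scalar (a (int i) ^ n)))"
  by (simp add: inv_shifted_power_def inv_linear_def prod.distrib)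

lemma inv_shifted_power_low: "n < k \<Longrightarrow> inv_shifted_power a k $ n = 0"
  by (simp add: inv_shifted_power_nth fps_X_power_mult_nth)

lemma inv_shifted_power_diag: "inv_shifted_power a k $ k = 1"
proof -
  have "(\<Prod>i\<in>A. Abs_fps (\<lambda>n. scalar (a (int i) ^ n))) $ 0 = 1" if "finite A" for A
    using that by (induction A) (simp_all add: scalar_1)
  thus ?thesis
    by (simp add: inv_shifted_power_nth fps_X_power_mult_nth)
qed

lemma H_series_0: "H_series $ 0 = 1"
  by (simp add: H_series_def fps_compose_nth scalar_1)

lemma is_h_expansion_iff:
  "is_h_expansion a h \<longleftrightarrow>
     (\<forall>n. h n = H_series $ n - (\<Sum>k<n. h k * inv_shifted_power a k $ n))"
  (is "_ \<longleftrightarrow> ?R")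
proof -
  let ?f = "\<lambda>k. fps_const (h k) * inv_shifted_power a k"
  have part: "(\<Sum>k<N. ?f k) $ n = h n + (\<Sum>k<n. h k * inv_shifted_power a k $ n)" if "n < N" for n N
  proof -
    have "(\<Sum>k<N. ?f k) $ n = (\<Sum>k<N. h k * inv_shifted_power a k $ n)"
      by (simp add: fps_sum_nth)
    also have "\<dots> = (\<Sum>k<Suc n. h k * inv_shifted_power a k $ n)"
      by (rule sum.mono_neutral_right) (use that in \<open>auto simp: inv_shifted_power_low\<close>)
    finally show ?thesis
      by (simp add: inv_shifted_power_diag)
  qed
  have "?f sums H_series \<longleftrightarrow> ?R"
  proof
    assume "?f sums H_series"
    hence ev: "\<forall>\<^sub>F N in sequentially. (\<Sum>k<N. ?f k) $ n = H_series $ n" for n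
      by (simp add: sums_def tendsto_fps_iff)
    show ?R
    proof
      fix n
      from ev[of n] obtain N0 where N0: "\<And>N. N \<ge> N0 \<Longrightarrow> (\<Sum>k<N. ?f k) $ n = H_series $ n"
        by (auto simp: eventually_sequentially)
      show "h n = H_series $ n - (\<Sum>k<n. h k * inv_shifted_power a k $ n)"
        using part[of n "max N0 (Suc n)"] N0[of "max N0 (Suc n)"] by simp
    qed
  next
    assume R: ?R
    show "?f sums H_series"
      unfolding sums_def
    proof (rule tendsto_fpsI)
      fix n
      have "(\<Sum>k<N. ?f k) $ n = H_series $ n" if "N > n" for N
        using part[OF that] R[rule_format, of n] by (simp add: algebra_simps)
      thus "\<forall>\<^sub>F N in sequentially. (\<Sum>k<N. ?f k) $ n = H_series $ n"
        by (rule eventually_mono[OF eventually_gt_at_top[of n]])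
    qed
  qed
  moreover have "h 0 = 1" if ?R
    using that[rule_format, of 0] by (simp add: H_series_0)
  ultimately show ?thesis
    unfolding is_h_expansion_def by blast
qed

fun h_rec :: "(int \<Rightarrow> complex) \<Rightarrow> nat \<Rightarrow> symf" where
  "h_rec a n = H_series $ n - (\<Sum>k<n. h_rec a k * inv_shifted_power a k $ n)"

declare h_rec.simps [simp del]

lemma ex1_h_expansion: "\<exists>!h. is_h_expansion a h"
proof
  show "is_h_expansion a (h_rec a)"
    unfolding is_h_expansion_iff by (intro allI, rule h_rec.simps)
next
  fix h assume h: "is_h_expansion a h"
  show "h = h_rec a"
  proof
    fix n show "h n = h_rec a n"
    proof (induction n rule: less_induct)
      case (less n)
      have "h n = H_series $ n - (\<Sum>k<n. h k * inv_shifted_power a k $ n)"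
        using h unfolding is_h_expansion_iff by blast
      also have "\<dots> = H_series $ n - (\<Sum>k<n. h_rec a k * inv_shifted_power a k $ n)"
        by (simp add: less)
      also have "\<dots> = h_rec a n"
        by (rule h_rec.simps [symmetric])
      finally show ?case .
    qed
  qed
qed

lemma h_multi_0: "h_multi a 0 = 1"
proof -
  have "is_h_expansion a (The (is_h_expansion a))"
    by (rule theI'[OF ex1_h_expansion])
  hence "(The (is_h_expansion a)) 0 = 1"
    unfolding is_h_expansion_def[of a "The (is_h_expansion a)"] by blast
  thus ?thesis
    by (simp add: h_multi_def)
qed

lemma h_multi_neg: "k < 0 \<Longrightarrow> h_multi a k = 0"
  by (simp add: h_multi_def)

lemma schur_multi_any_order:
  assumes "n \<ge> length \<mu>"
  shows "det (jacobi_trudi a \<mu> n) = schur_multi a \<mu>"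
  using assms
proof (induction n rule: dec_induct)
  case base
  show ?case by (simp add: schur_multi_def)
next
  case (step n)
  let ?A = "jacobi_trudi a \<mu> (Suc n)"
  have row: "?A $$ (n, j) = (if j = n then 1 else 0)" if "j < Suc n" for j
    using that step.hyps by (auto simp: jacobi_trudi_def row_len_def h_multi_0 h_multi_neg)
  have "det ?A = (\<Sum>j<Suc n. ?A $$ (n, j) * cofactor ?A n j)"
    by (rule laplace_expansion_row) (auto simp: jacobi_trudi_def)
  also have "\<dots> = cofactor ?A n n"
    by (simp add: row)
  also have "\<dots> = det (mat_delete ?A n n)"
    by (simp add: cofactor_def)
  also have "mat_delete ?A n n = jacobi_trudi a \<mu> n"
    by (rule eq_matI) (auto simp: jacobi_trudi_def mat_delete_def)
  finally show ?case
    using step.IH by simp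
qed

no_notation fps_nth (infixl "$" 75)
notation vec_index (infixl "$" 100)

end

theory Submission
  imports Defs
begin

text \<open>
  The argument is linear algebra resting on \<open>h\<^bsub>0;a\<^esub> = 1\<close> and \<open>h\<^bsub>k;a\<^esub> = 0\<close> for \<open>k < 0\<close>.

  For an integer \<open>c\<close> let \<open>R\<^sub>c\<close> be the vector with \<open>j\<close>-th entry \<open>h\<^bsub>c+j;\<tau>\<^sup>1\<^sup>-\<^sup>ja\<^esub>\<close>,
  \<open>1 \<le> j \<le> n\<close>. Then \<open>s\<^bsub>\<mu>;a\<^esub>\<close> is the determinant with rows \<open>R\<^sub>c\<close>, where \<open>c\<close> runs through the
  numbers \<open>\<mu>\<^sub>i - i\<close> in decreasing order. The nonnegative ones among these are
  \<open>p\<^sub>1, \<dots>, p\<^sub>d\<close>, the negative ones are \<open>-1, \<dots>, -n\<close> without \<open>-q\<^sub>1 - 1, \<dots>, -q\<^sub>d - 1\<close>. The matrix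
  \<open>U\<close> with rows \<open>R\<^sub>-\<^sub>1, \<dots>, R\<^sub>-\<^sub>n\<close> is upper unitriangular, so every matrix of this kind can be
  divided by \<open>U\<close> from the right without changing its determinant. After the division the rows
  with negative \<open>c\<close> are unit vectors, and expanding along them leaves the \<open>d \<times> d\<close> minor
  of the columns \<open>q\<^sub>1 + 1, \<dots>, q\<^sub>d + 1\<close>, where the column of \<open>q\<^sub>j\<close> acquires the sign
  \<open>(-1)\<^sup>q\<close> with \<open>q = q\<^sub>j\<close>; this is the content of \<open>det_unit_rows\<close> and \<open>det_common_rows\<close>.

  For a hook \<open>(p | q)\<close> the minor has size 1, so that \<open>s\<^bsub>(p|q);a\<^esub>\<close> is, up to the sign
  \<open>(-1)\<^sup>q\<close>, the entry in column \<open>q + 1\<close> of the vector \<open>R\<^sub>p U\<^sup>-\<^sup>1\<close> (\<open>schur_hook\<close>). Hence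
  for general \<open>\<mu>\<close> the entries of the minor, with their signs, are exactly the hook functions.
\<close>

section \<open>Determinants with unit rows\<close>

lemma strict_mono_on_endo_id:
  fixes k :: "nat \<Rightarrow> nat"
  assumes "strict_mono_on {..<n} k" and "\<And>i. i < n \<Longrightarrow> k i < n" and "i < n"
  shows "k i = i"
proof -
  have le_k: "i \<le> k i" if "i < n" for i
    using that
  proof (induction i)
    case (Suc i)
    moreover have "k i < k (Suc i)"
      using Suc.prems by (intro strict_mono_onD[OF assms(1)]) auto
    ultimately show ?case by simp
  qed simp
  have "k i + m \<le> k (i + m)" if "i + m < n" for m
    using that
  proof (induction m)
    case (Suc m)
    moreover have "k (i + m) < k (i + Suc m)"
      using Suc.prems by (intro strict_mono_onD[OF assms(1)]) auto
    ultimately show ?case by simp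
  qed simp
  from this[of "n - 1 - i"] have "k i + (n - 1 - i) \<le> k (n - 1)"
    using assms(3) by simp
  moreover have "i \<le> k i"
    using le_k assms(3) by simp
  ultimately show ?thesis
    using assms(2)[of "n - 1"] assms(3) by simp
qed

text \<open>
  The sign comes from moving the columns \<open>q 0 > q 1 > \<dots>\<close> to the front: since larger columns are
  moved earlier, column \<open>q j\<close> passes exactly \<open>q j\<close> others on its way to position \<open>j\<close>
  (the \<open>j\<close> columns moved before it came from its right). The induction does this by expanding both
  determinants along the column \<open>q 0\<close>. Its entries in the unit rows vanish, and as \<open>q 0\<close> is the
  largest of the \<open>q j\<close>, deleting it leaves the positions of the remaining ones unchanged; only the
  positions \<open>k i\<close> of the units to its right drop by one.
\<close>
lemma det_unit_rows:
  fixes C :: "'a :: comm_ring_1 mat"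
  assumes "C \<in> carrier_mat n n" and "d \<le> n"
    and "\<And>i j. d \<le> i \<Longrightarrow> i < n \<Longrightarrow> j < n \<Longrightarrow> C $$ (i, j) = (if j = k i then 1 else 0)"
    and "\<And>i. d \<le> i \<Longrightarrow> i < n \<Longrightarrow> k i < n"
    and "strict_mono_on {d..<n} k"
    and "\<And>j. j < d \<Longrightarrow> q j < n"
    and "\<And>j j'. j < j' \<Longrightarrow> j' < d \<Longrightarrow> q j' < q j"
    and "\<And>i j. d \<le> i \<Longrightarrow> i < n \<Longrightarrow> j < d \<Longrightarrow> k i \<noteq> q j"
  shows "det C = det (mat d d (\<lambda>(i, j). (-1) ^ q j * C $$ (i, q j)))"
  using assms
proof (induction d arbitrary: n C q k)
  case 0
  \<comment> \<open>Without free rows the units stand on the diagonal.\<close>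
  have "k i = i" if "i < n" for i
    using that 0 by (intro strict_mono_on_endo_id[of n]) (auto simp: lessThan_atLeast0)
  hence "C = 1\<^sub>m n"
    using 0 by (intro eq_matI) auto
  thus ?case by simp
next
  case (Suc d)
  let ?R = "mat (Suc d) (Suc d) (\<lambda>(i, j). (-1) ^ q j * C $$ (i, q j))"
  note C = Suc.prems(1) and row = Suc.prems(3) and k_less = Suc.prems(4)
    and k_mono = Suc.prems(5) and q_less = Suc.prems(6) and q_dec = Suc.prems(7)
    and disj = Suc.prems(8)
  obtain m where n: "n = Suc m" and dm: "d \<le> m"
    using Suc.prems(2) by (cases n) auto
  define k' where "k' i = (if k (Suc i) < q 0 then k (Suc i) else k (Suc i) - 1)" for i
  have q0: "q 0 < n" using q_less[of 0] by simp
  have ne: "k (Suc i) \<noteq> q 0" if "d \<le> i" "i < m" for i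
    using that disj[of "Suc i" 0] n by auto
  have minor: "det (mat_delete C i (q 0)) = det (mat_delete ?R i 0)" if i: "i < Suc d" for i
  proof -
    let ?D = "mat_delete C i (q 0)"
    have D: "?D $$ (i', j') = C $$ (if i' < i then i' else Suc i', if j' < q 0 then j' else Suc j')"
      if "i' < m" "j' < m" for i' j'
      using that C n by (simp add: mat_delete_def)
    have "det ?D = det (mat d d (\<lambda>(i', j'). (-1) ^ q (Suc j') * ?D $$ (i', q (Suc j'))))"
    proof (rule Suc.IH[of ?D m k'])
      show "?D \<in> carrier_mat m m"
        using C n by (simp add: mat_delete_def)
      show "d \<le> m" by (rule dm)
      show "?D $$ (i', j') = (if j' = k' i' then 1 else 0)" if "d \<le> i'" "i' < m" "j' < m" for i' j'
        using that i ne[of i'] row[of "Suc i'" "if j' < q 0 then j' else Suc j'"] n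
        by (auto simp: D k'_def)
      show "k' i' < m" if "d \<le> i'" "i' < m" for i'
        using that k_less[of "Suc i'"] ne[of i'] n q0 by (auto simp: k'_def)
      show "strict_mono_on {d..<m} k'"
      proof (rule strict_mono_onI)
        fix r s assume "r \<in> {d..<m}" "s \<in> {d..<m}" "r < s"
        moreover from this have "k (Suc r) < k (Suc s)"
          using n by (intro strict_mono_onD[OF k_mono]) auto
        ultimately show "k' r < k' s"
          using ne[of r] ne[of s] by (auto simp: k'_def)
      qed
      show "q (Suc j) < m" if "j < d" for j
        using that q_dec[of 0 "Suc j"] q0 n by simp
      show "q (Suc j') < q (Suc j)" if "j < j'" "j' < d" for j j'
        using that q_dec by simp
      show "k' i' \<noteq> q (Suc j)" if "d \<le> i'" "i' < m" "j < d" for i' j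
        using that disj[of "Suc i'" "Suc j"] q_dec[of 0 "Suc j"] ne[of i'] n by (auto simp: k'_def)
    qed
    also have "mat d d (\<lambda>(i', j'). (-1) ^ q (Suc j') * ?D $$ (i', q (Suc j'))) = mat_delete ?R i 0"
    proof (rule eq_matI)
      fix i' j' assume "i' < dim_row (mat_delete ?R i 0)" "j' < dim_col (mat_delete ?R i 0)"
      hence "i' < d" "j' < d" by (auto simp: mat_delete_def)
      moreover have "q (Suc j') < q 0"
        using \<open>j' < d\<close> by (intro q_dec) auto
      ultimately show "mat d d (\<lambda>(i', j'). (-1) ^ q (Suc j') * ?D $$ (i', q (Suc j'))) $$ (i', j')
          = mat_delete ?R i 0 $$ (i', j')"
        using dm q0 n carrier_matD[OF C] by (auto simp: mat_delete_def)
    qed (auto simp: mat_delete_def)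
    finally show ?thesis .
  qed
  have "det C = (\<Sum>i<n. C $$ (i, q 0) * cofactor C i (q 0))"
    using C q0 by (rule laplace_expansion_column)
  also have "\<dots> = (\<Sum>i<Suc d. C $$ (i, q 0) * cofactor C i (q 0))"
  proof (rule sum.mono_neutral_right)
    show "\<forall>i\<in>{..<n} - {..<Suc d}. C $$ (i, q 0) * cofactor C i (q 0) = 0"
    proof
      fix i assume "i \<in> {..<n} - {..<Suc d}"
      thus "C $$ (i, q 0) * cofactor C i (q 0) = 0"
        using row[of i "q 0"] disj[of i 0] q0 by simp
    qed
  qed (use Suc.prems(2) in auto)
  also have "\<dots> = (\<Sum>i<Suc d. ?R $$ (i, 0) * cofactor ?R i 0)"
    by (intro sum.cong) (simp_all add: cofactor_def minor power_add mult_ac)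
  also have "\<dots> = det ?R"
    by (rule laplace_expansion_column[symmetric]) auto
  finally show ?case .
qed

text \<open>
  Because \<open>det U = 1\<close>, the adjugate of \<open>U\<close> is its inverse over any commutative ring. Multiplying
  by it turns a row that \<open>M\<close> shares with \<open>U\<close> into a unit vector.
\<close>
lemma det_common_rows:
  fixes M U :: "'a :: comm_ring_1 mat"
  assumes M: "M \<in> carrier_mat n n" and U: "U \<in> carrier_mat n n" and detU: "det U = 1"
    and "d \<le> n"
    and k_row: "\<And>i. d \<le> i \<Longrightarrow> i < n \<Longrightarrow> row M i = row U (k i)"
    and k_less: "\<And>i. d \<le> i \<Longrightarrow> i < n \<Longrightarrow> k i < n"
    and "strict_mono_on {d..<n} k"
    and "\<And>j. j < d \<Longrightarrow> q j < n"
    and "\<And>j j'. j < j' \<Longrightarrow> j' < d \<Longrightarrow> q j' < q j"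
    and "\<And>i j. d \<le> i \<Longrightarrow> i < n \<Longrightarrow> j < d \<Longrightarrow> k i \<noteq> q j"
  shows "det M = det (mat d d (\<lambda>(i, j). (-1) ^ q j * (row M i \<bullet> col (adj_mat U) (q j))))"
proof -
  have "(1 :: 'a) \<cdot>\<^sub>m 1\<^sub>m n = 1\<^sub>m n"
    by (intro eq_matI) auto
  note adj = adj_mat[OF U, unfolded detU this]
  let ?C = "M * adj_mat U"
  have entry: "?C $$ (i, j) = row M i \<bullet> col (adj_mat U) j" if "i < n" "j < n" for i j
    using that M adj(1) by simp
  have "?C * U = M"
    using M U adj by (simp add: assoc_mult_mat[of M n n _ n U n])
  hence "det M = det ?C"
    using M U adj(1) det_mult[of ?C n U] detU by simp
  also have "\<dots> = det (mat d d (\<lambda>(i, j). (-1) ^ q j * ?C $$ (i, q j)))"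
  proof (rule det_unit_rows)
    show "?C \<in> carrier_mat n n" using M adj(1) by simp
    show "?C $$ (i, j) = (if j = k i then 1 else 0)" if "d \<le> i" "i < n" "j < n" for i j
    proof -
      have "?C $$ (i, j) = (U * adj_mat U) $$ (k i, j)"
        using that U adj(1) k_less[of i] by (simp add: entry k_row del: index_mult_mat(1)) simp
      also have "\<dots> = 1\<^sub>m n $$ (k i, j)"
        by (simp add: adj(2))
      finally show ?thesis
        using that k_less[of i] by auto
    qed
  qed (use assms in auto)
  also have "mat d d (\<lambda>(i, j). (-1) ^ q j * ?C $$ (i, q j)) =
      mat d d (\<lambda>(i, j). (-1) ^ q j * (row M i \<bullet> col (adj_mat U) (q j)))"
    using assms(4,8) by (intro eq_matI) (auto simp: entry simp del: index_mult_mat(1))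
  finally show ?thesis .
qed

section \<open>Rows of Jacobi--Trudi matrices\<close>

text \<open>
  The \<open>i\<close>-th row of a Jacobi--Trudi matrix depends on the diagram only through the number
  \<open>c = \<mu>\<^sub>i - i\<close>. Columns count from 0 here, hence \<open>c + j + 1\<close> and the shift by \<open>-j\<close>.
\<close>
definition jt_row :: "(int \<Rightarrow> complex) \<Rightarrow> nat \<Rightarrow> int \<Rightarrow> symf vec" where
  "jt_row a n c = vec n (\<lambda>j. h_multi (shift (- int j) a) (c + int j + 1))"

lemma row_jacobi_trudi:
  "i < n \<Longrightarrow> row (jacobi_trudi a \<mu> n) i = jt_row a n (int (row_len \<mu> (Suc i)) - int (Suc i))"
  by (intro eq_vecI) (auto simp: jacobi_trudi_def jt_row_def Let_def algebra_simps)

text \<open>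
  The matrix \<open>U\<close> of the introduction: it supplies all rows with \<open>c < 0\<close>, whatever the diagram.
\<close>
definition ground_mat :: "(int \<Rightarrow> complex) \<Rightarrow> nat \<Rightarrow> symf mat" where
  "ground_mat a n = mat_of_rows n (map (\<lambda>i. jt_row a n (- int i - 1)) [0..<n])"

lemma ground_mat_carrier: "ground_mat a n \<in> carrier_mat n n"
  unfolding ground_mat_def by (auto intro!: mat_of_rows_carrier)

lemma row_ground_mat: "i < n \<Longrightarrow> c = - int i - 1 \<Longrightarrow> row (ground_mat a n) i = jt_row a n c"
  unfolding ground_mat_def by (subst mat_of_rows_row) (auto simp: jt_row_def)

lemma det_ground_mat: "det (ground_mat a n) = 1"
proof -
  have index: "ground_mat a n $$ (i, j) = h_multi (shift (- int j) a) (int j - int i)"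
    if "i < n" "j < n" for i j
    using that by (simp add: ground_mat_def mat_of_rows_def jt_row_def algebra_simps)
  have "upper_triangular (ground_mat a n)"
    using ground_mat_carrier[of a n] by (intro upper_triangularI) (auto simp: index h_multi_neg)
  moreover have "diag_mat (ground_mat a n) = map (\<lambda>_. 1) [0..<n]"
    using ground_mat_carrier[of a n] by (auto simp: diag_mat_def index h_multi_0)
  ultimately show ?thesis
    using det_upper_triangular[OF _ ground_mat_carrier, of a n] by (simp add: map_replicate_const)
qed

text \<open>
  The rows of the hook belong to \<open>p, -1, \<dots>, -q, -q-2, \<dots>, -n\<close>. All but the first are rows of
  \<open>ground_mat\<close>, so there is a single free row and a single missing index, \<open>q\<close>. The order
  \<open>n\<close> is arbitrary in order that all hooks can be compared with one larger diagram.
\<close>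
lemma schur_hook:
  assumes "q < n"
  shows "schur_multi a (hook p q) =
    (-1) ^ q * (jt_row a n (int p) \<bullet> col (adj_mat (ground_mat a n)) q)"
proof -
  let ?M = "jacobi_trudi a (hook p q) n"
  let ?k = "\<lambda>i. if i \<le> q then i - 1 else i"
  have len: "row_len (hook p q) (Suc i) = (if i = 0 then p + 1 else if i \<le> q then 1 else 0)" for i
    by (auto simp: row_len_def hook_def nth_Cons')
  have M: "?M \<in> carrier_mat n n" by (simp add: jacobi_trudi_def)
  have "schur_multi a (hook p q) = det ?M"
    using assms by (intro schur_multi_any_order[symmetric]) (simp add: hook_def)
  also have "\<dots> = det (mat 1 1 (\<lambda>(i, j). (-1) ^ q * (row ?M i \<bullet> col (adj_mat (ground_mat a n)) q)))"
  proof (rule det_common_rows[where k = ?k])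
    show "row ?M i = row (ground_mat a n) (?k i)" if "1 \<le> i" "i < n" for i
      using that by (subst row_ground_mat[of _ n]) (auto simp: row_jacobi_trudi len)
    show "strict_mono_on {1..<n} ?k"
      by (rule strict_mono_onI) auto
  qed (use assms M ground_mat_carrier det_ground_mat in \<open>auto split: if_splits\<close>)
  also have "\<dots> = (-1) ^ q * (row ?M 0 \<bullet> col (adj_mat (ground_mat a n)) q)"
    by (subst det_single) (auto simp: det_single)
  finally show ?thesis
    using assms by (simp add: row_jacobi_trudi len)
qed

section \<open>Frobenius coordinates\<close>

lemma row_len_antimono:
  assumes "young \<mu>" and "1 \<le> i" and "i \<le> i'"
  shows "row_len \<mu> i' \<le> row_len \<mu> i"
proof (cases "i = i'")
  case False
  thus ?thesis
    using assms sorted_wrt_nth_less[of "(\<ge>)" \<mu> "i - 1" "i' - 1"]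
    by (auto simp: row_len_def young_def)
qed simp

text \<open>
  This turns the cardinalities that define \<open>diag_length\<close> and \<open>col_len\<close> into inequalities.
\<close>
lemma down_closed_eq_atMost:
  fixes A :: "nat set"
  assumes "finite A" and "0 \<notin> A" and "\<And>i i'. i' \<in> A \<Longrightarrow> 1 \<le> i \<Longrightarrow> i \<le> i' \<Longrightarrow> i \<in> A"
  shows "A = {1..card A}"
proof (cases "A = {}")
  case False
  have pos: "1 \<le> i" if "i \<in> A" for i
    using that assms(2) by (cases i) auto
  have mem: "i \<in> A" if "1 \<le> i" "i \<le> Max A" for i
    using that assms(3)[OF Max_in[OF assms(1) False]] by simp
  have A: "A = {1..Max A}"
    using pos mem Max_ge[OF assms(1)] by (meson atLeastAtMost_iff subsetI subset_antisym)
  have card: "card A = Max A"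
    using arg_cong[OF A, of card] by simp
  show ?thesis
    unfolding card by (rule A)
qed simp

lemma le_diag_length_iff:
  assumes "young \<mu>" and "1 \<le> i"
  shows "i \<le> diag_length \<mu> \<longleftrightarrow> i \<le> row_len \<mu> i"
proof -
  let ?A = "{i. (i, i) \<in> squares \<mu>}"
  have "?A = {1..card ?A}"
  proof (rule down_closed_eq_atMost)
    show "finite ?A"
      by (rule finite_subset[of _ "{..length \<mu>}"]) (auto simp: squares_def row_len_def split: if_splits)
    show "i \<in> ?A" if "i' \<in> ?A" "1 \<le> i" "i \<le> i'" for i i'
      using that row_len_antimono[OF assms(1), of i i'] by (auto simp: squares_def)
  qed (auto simp: squares_def)
  from this[THEN eqset_imp_iff, of i] show ?thesis
    using assms(2) by (auto simp: diag_length_def squares_def)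
qed

lemma le_col_len_iff:
  assumes "young \<mu>" and "1 \<le> i" and "1 \<le> j"
  shows "i \<le> col_len \<mu> j \<longleftrightarrow> j \<le> row_len \<mu> i"
proof -
  let ?A = "{i. (i, j) \<in> squares \<mu>}"
  have "?A = {1..card ?A}"
  proof (rule down_closed_eq_atMost)
    show "finite ?A"
      by (rule finite_subset[of _ "{..length \<mu>}"]) (auto simp: squares_def row_len_def split: if_splits)
    show "i \<in> ?A" if "i' \<in> ?A" "1 \<le> i" "i \<le> i'" for i i'
      using that row_len_antimono[OF assms(1), of i i'] by (auto simp: squares_def)
  qed (auto simp: squares_def)
  from this[THEN eqset_imp_iff, of i] show ?thesis
    using assms(2,3) by (auto simp: col_len_def squares_def)
qed

section \<open>The Giambelli formula\<close>

theorem proposition3p1: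
  fixes a :: "int \<Rightarrow> complex" and \<mu> :: "nat list"
  assumes "young \<mu>"
  shows "schur_multi a \<mu> =
    det (mat (diag_length \<mu>) (diag_length \<mu>)
      (\<lambda>(i, j). schur_multi a (hook (frob_p \<mu> (Suc i)) (frob_q \<mu> (Suc j)))))"
proof -
  define n d where "n = length \<mu>" and "d = diag_length \<mu>"
  \<comment> \<open>Below the diagonal part, row \<open>i\<close> belongs to \<open>\<mu>\<^sub>i\<^sub>+\<^sub>1 - (i + 1) = -(k i + 1)\<close>.\<close>
  define k where "k i = i - row_len \<mu> (Suc i)" for i
  define q where "q j = frob_q \<mu> (Suc j)" for j
  let ?M = "jacobi_trudi a \<mu> n"
  have diag: "i < d \<longleftrightarrow> i < row_len \<mu> (Suc i)" for i
    using le_diag_length_iff[OF assms, of "Suc i"] by (simp add: d_def Suc_le_eq)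
  have col: "i < col_len \<mu> (Suc j) \<longleftrightarrow> j < row_len \<mu> (Suc i)" for i j
    using le_col_len_iff[OF assms, of "Suc i" "Suc j"] by (simp add: Suc_le_eq)
  have row_zero: "row_len \<mu> (Suc n) = 0"
    by (simp add: row_len_def n_def)
  have col_le: "col_len \<mu> (Suc j) \<le> n" for j
    using col[of n j] row_zero by simp
  have diag_col: "j < col_len \<mu> (Suc j)" if "j < d" for j
    using that diag[of j] col[of j j] by simp
  have col_anti: "col_len \<mu> (Suc j') \<le> col_len \<mu> (Suc j)" if "j \<le> j'" for j j'
    by (rule leI) (use that col[of "col_len \<mu> (Suc j)" j] col[of "col_len \<mu> (Suc j)" j'] in simp)
  have below: "row_len \<mu> (Suc i) \<le> i" if "d \<le> i" for i
    using that diag[of i] by simp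
  have q_less: "q j < n" if "j < d" for j
    using diag_col[OF that] col_le[of j] by (simp add: q_def frob_q_def)
  have M: "?M \<in> carrier_mat n n" by (simp add: jacobi_trudi_def)
  have dn: "d \<le> n"
    using diag[of n] row_zero by simp
  have "schur_multi a \<mu> = det ?M"
    by (simp add: schur_multi_def n_def)
  also have "\<dots> = det (mat d d (\<lambda>(i, j). (-1) ^ q j * (row ?M i \<bullet> col (adj_mat (ground_mat a n)) (q j))))"
  proof (rule det_common_rows[where k = k])
    show "row ?M i = row (ground_mat a n) (k i)" if "d \<le> i" "i < n" for i
    proof -
      have "k i < n" using that by (simp add: k_def)
      thus ?thesis
        using that below[of i] by (subst row_ground_mat[of _ n]) (auto simp: row_jacobi_trudi k_def)
    qed
    show "strict_mono_on {d..<n} k"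
    proof (rule strict_mono_onI)
      fix r s assume "r \<in> {d..<n}" "s \<in> {d..<n}" "r < s"
      thus "k r < k s"
        using row_len_antimono[OF assms, of "Suc r" "Suc s"] below[of r] below[of s] by (simp add: k_def)
    qed
    show "q j' < q j" if "j < j'" "j' < d" for j j'
      using that col_anti[of j j'] diag_col[of j'] by (simp add: q_def frob_q_def)
    \<comment> \<open>A square in row \<open>i\<close> and column \<open>j\<close> (from 0) makes \<open>k i < i - j \<le> q j\<close>;
      its absence makes \<open>q j < i - j \<le> k i\<close>.\<close>
    show "k i \<noteq> q j" if "d \<le> i" "i < n" "j < d" for i j
      using that col[of i j] below[of i] diag_col[of j]
      by (cases "i < col_len \<mu> (Suc j)") (auto simp: k_def q_def frob_q_def)
  qed (use M ground_mat_carrier det_ground_mat dn q_less in \<open>auto simp: k_def\<close>)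
  also have "\<dots> = det (mat d d (\<lambda>(i, j). schur_multi a (hook (frob_p \<mu> (Suc i)) (q j))))"
  proof (intro arg_cong[of _ _ det] cong_mat refl, clarsimp)
    fix i j assume "i < d" "j < d"
    have "int (frob_p \<mu> (Suc i)) = int (row_len \<mu> (Suc i)) - int (Suc i)"
      unfolding frob_p_def by (rule of_nat_diff) (use diag[of i] \<open>i < d\<close> in simp)
    thus "(-1) ^ q j * (row ?M i \<bullet> col (adj_mat (ground_mat a n)) (q j)) =
        schur_multi a (hook (frob_p \<mu> (Suc i)) (q j))"
      using \<open>i < d\<close> \<open>j < d\<close> dn
      by (simp only: schur_hook[OF q_less] row_jacobi_trudi[OF less_le_trans])
  qed
  finally show ?thesis
    by (simp add: d_def q_def)
qed

end
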